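(* Let $A^\ast_{n,\le m}$, $\xi_n$, $\alpha_j$ be taken from any one of the four families (Bernoulli, Cauchy, Euler, Euler of the second kind) described in the context. For positive integers $N$, $n$ and $m$, we have $$A_{n,\le m}^\ast=\xi_n\sum_{k=1}^n(-1)^{n-k}\binom{n+1}{k+1}\sum_{\substack{i_1+\cdots+i_k=n\\ 0\le i_1,\dots,i_k\le m}}\alpha_{i_1}\cdots\alpha_{i_k}.$$
   Context: $(x)^{(n)}=x(x+1)\cdots(x+n-1)$ for $n\ge1$ and $(x)^{(0)}=1$ (rising factorial). All identities below are between formal power series in $x$. For integers $N\ge1$ and $m\ge 1$ define the modified restricted hypergeometric numbers by: - Bernoulli: $\left(\sum_{n=0}^{m}\frac{x^n}{(N+1)^{(n)}}\right)^{-1}=\sum_{n=0}^\infty B_{N,n,\le m}^\ast\frac{x^n}{n!}$; - Cauchy: $\left(N\sum_{n=0}^{m}\frac{(-x)^n}{N+n}\right)^{-1}=\sum_{n=0}^\infty c_{N,n,\le m}^\ast\frac{x^n}{n!}$; - Euler: $\left(\sum_{n=0}^{m}\frac{x^{2n}}{(2N+1)^{(2n)}}\right)^{-1}=\sum_{n=0}^\infty E_{N,n,\le m}^\ast\frac{x^n}{n!}$; - Euler of the second kind: $\left(\sum_{n=0}^{m}\frac{x^{2n}}{(2N+2)^{(2n)}}\right)^{-1}=\sum_{n=0}^\infty\widehat E_{N,n,\le m}^\ast\frac{x^n}{n!}$. The symbols $A^\ast_{n,\le m}$, $\xi_n$ ($n\ge0$), $\alpha_j$ ($j\ge0$, so that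 $\alpha_0=1$ in every case) denote simultaneously one of the following choices ($N$ is suppressed from the notation): - Bernoulli: $A^\ast_{n,\le m}=B^\ast_{N,n,\le m}$, $\xi_n=(-1)^n n!$, $\alpha_j=\frac{N!}{(N+j)!}$; - Cauchy: $A^\ast_{n,\le m}=c^\ast_{N,n,\le m}$, $\xi_n=n!$, $\alpha_j=\frac{N}{N+j}$; - Euler: $A^\ast_{n,\le m}=E^\ast_{N,2n,\le m}$, $\xi_n=(-1)^n(2n)!$, $\alpha_j=\frac{(2N)!}{(2N+2j)!}$; - Euler of the second kind: $A^\ast_{n,\le m}=\widehat E^\ast_{N,2n,\le m}$, $\xi_n=(-1)^n(2n)!$, $\alpha_j=\frac{(2N+1)!}{(2N+2j+1)!}$. Inner sums run over ordered $k$-tuples of integers. *)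

theory Defs
  imports "HOL-Computational_Algebra.Formal_Power_Series"
begin

text \<open>Modified restricted hypergeometric numbers. Each generating function is the inverse of a
  polynomial with constant term 1 (for \<open>N \<ge> 1\<close>), so \<^const>\<open>inverse\<close> on \<open>rat fps\<close> is a true
  inverse. The prefix \<open>euler2\<close> refers to the Euler numbers of the second kind; \<^const>\<open>pochhammer\<close>
  is the rising factorial.\<close>

definition bernoulli_gf :: "nat \<Rightarrow> nat \<Rightarrow> rat fps" where
  "bernoulli_gf N m =
     inverse (\<Sum>n=0..m. fps_const (1 / pochhammer (of_nat (N + 1)) n) * fps_X ^ n)"

definition cauchy_gf :: "nat \<Rightarrow> nat \<Rightarrow> rat fps" where
  "cauchy_gf N m =
     inverse (fps_const (of_nat N) * (\<Sum>n=0..m. fps_const (1 / of_nat (N + n)) * (- fps_X) ^ n))"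

definition euler_gf :: "nat \<Rightarrow> nat \<Rightarrow> rat fps" where
  "euler_gf N m =
     inverse (\<Sum>n=0..m. fps_const (1 / pochhammer (of_nat (2*N + 1)) (2*n)) * fps_X ^ (2*n))"

definition euler2_gf :: "nat \<Rightarrow> nat \<Rightarrow> rat fps" where
  "euler2_gf N m =
     inverse (\<Sum>n=0..m. fps_const (1 / pochhammer (of_nat (2*N + 2)) (2*n)) * fps_X ^ (2*n))"

definition egf_coeff :: "rat fps \<Rightarrow> nat \<Rightarrow> rat" where
  "egf_coeff F n = fact n * fps_nth F n"

lemma egf_coeff_unique:
  "F = Abs_fps (\<lambda>n. a n / fact n) \<longleftrightarrow> a = egf_coeff F"
  by (auto simp: egf_coeff_def fps_eq_iff fun_eq_iff field_simps)

definition bernoulli_star :: "nat \<Rightarrow> nat \<Rightarrow> nat \<Rightarrow> rat" where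
  "bernoulli_star N n m = egf_coeff (bernoulli_gf N m) n"

definition cauchy_star :: "nat \<Rightarrow> nat \<Rightarrow> nat \<Rightarrow> rat" where
  "cauchy_star N n m = egf_coeff (cauchy_gf N m) n"

definition euler_star :: "nat \<Rightarrow> nat \<Rightarrow> nat \<Rightarrow> rat" where
  "euler_star N n m = egf_coeff (euler_gf N m) n"

definition euler2_star :: "nat \<Rightarrow> nat \<Rightarrow> nat \<Rightarrow> rat" where
  "euler2_star N n m = egf_coeff (euler2_gf N m) n"

datatype family = Bernoulli | Cauchy | Euler | Euler2

fun A_star :: "family \<Rightarrow> nat \<Rightarrow> nat \<Rightarrow> nat \<Rightarrow> rat" where
  "A_star Bernoulli N n m = bernoulli_star N n m"
| "A_star Cauchy N n m = cauchy_star N n m"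
| "A_star Euler N n m = euler_star N (2*n) m"
| "A_star Euler2 N n m = euler2_star N (2*n) m"

fun xi :: "family \<Rightarrow> nat \<Rightarrow> rat" where
  "xi Bernoulli n = (-1) ^ n * fact n"
| "xi Cauchy n = fact n"
| "xi Euler n = (-1) ^ n * fact (2*n)"
| "xi Euler2 n = (-1) ^ n * fact (2*n)"

fun alpha :: "family \<Rightarrow> nat \<Rightarrow> nat \<Rightarrow> rat" where
  "alpha Bernoulli N j = fact N / fact (N + j)"
| "alpha Cauchy N j = of_nat N / of_nat (N + j)"
| "alpha Euler N j = fact (2*N) / fact (2*N + 2*j)"
| "alpha Euler2 N j = fact (2*N + 1) / fact (2*N + 2*j + 1)"

definition restricted_tuples :: "nat \<Rightarrow> nat \<Rightarrow> nat \<Rightarrow> nat list set" where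
  "restricted_tuples k n m = {is. length is = k \<and> sum_list is = n \<and> (\<forall>i\<in>set is. i \<le> m)}"

lemma finite_restricted_tuples: "finite (restricted_tuples k n m)"
  by (rule finite_subset[OF _ finite_lists_length_eq[of "{..m}" k]])
     (auto simp: restricted_tuples_def)

end

theory Submission imports Defs
begin

text \<open>
  All four families are one statement about a polynomial \<open>P = \<Sum>j\<le>m. a j * X ^ j\<close> with
  \<open>a 0 = 1\<close>: each generating function is \<open>1 / P\<close> with \<open>X\<close> replaced by \<open>X\<close>, \<open>- X\<close> or \<open>X ^ 2\<close>.
  The factor \<^const>\<open>xi\<close> collects the factorial of the exponential normalisation, the sign
  \<open>(-1) ^ n\<close> from writing \<open>(-1) ^ k\<close> as \<open>(-1) ^ n * (-1) ^ (n - k)\<close>, and the effect of the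
  substitution on coefficients.

  Since \<open>1 - P\<close> has no constant term, \<open>(1 - P) ^ (n + 1)\<close> vanishes to order \<open>n + 1\<close>. Dividing the
  binomial expansion of this power by \<open>P\<close> therefore gives
  \<open>1 / P = (\<Sum>k\<le>n. (-1) ^ k * (n + 1 choose (k + 1)) * P ^ k)\<close> up to terms of degree above \<open>n\<close>
  (lemma \<open>fps_nth_inverse_eq_sum_powers\<close>). The coefficient of \<open>X ^ n\<close> in \<open>P ^ k\<close> is the sum over
  restricted tuples (lemma \<open>fps_nth_power_truncated_series\<close>), and for \<open>n \<ge> 1\<close> the power with
  \<open>k = 0\<close> does not contribute. Working with powers of \<open>P\<close> rather than of \<open>1 - P\<close> is what produces
  the coefficient \<open>n + 1 choose (k + 1)\<close> and allows zero entries in the tuples.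
\<close>

unbundle fps_syntax

definition truncated_series :: "(nat \<Rightarrow> 'a::field) \<Rightarrow> nat \<Rightarrow> 'a fps" where
  "truncated_series a m = Abs_fps (\<lambda>j. if j \<le> m then a j else 0)"

lemma truncated_series_conv_sum:
  "truncated_series a m = (\<Sum>j=0..m. fps_const (a j) * fps_X ^ j)"
  by (rule fps_ext) (simp add: truncated_series_def fps_sum_nth mult_delta_right sum.delta)

lemma truncated_series_compose:
  assumes "u $ 0 = 0"
  shows "truncated_series a m oo u = (\<Sum>j=0..m. fps_const (a j) * u ^ j)"
  unfolding truncated_series_conv_sum fps_compose_sum_distrib
  using assms by (simp add: fps_compose_mult_distrib fps_X_power_compose)

text \<open>With \<open>u = - X\<close> or \<open>u = X ^ 2\<close> this reduces the Cauchy and Euler families to \<open>1 / P\<close>.\<close>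

lemma inverse_sum_eq_compose:
  assumes "u $ 0 = 0" and "a 0 \<noteq> 0"
  shows "inverse (\<Sum>j=0..m. fps_const (a j) * u ^ j) = inverse (truncated_series a m) oo u"
  using assms fps_inverse_compose[of u "truncated_series a m"]
  by (simp add: truncated_series_compose) (simp add: truncated_series_def)

lemma fps_nth_power_truncated_series:
  assumes "k \<ge> 1"
  shows "(truncated_series a m ^ k) $ n =
    (\<Sum>is\<in>restricted_tuples k n m. prod_list (map a is))"
proof -
  let ?P = "truncated_series a m"
  have prod_eq: "(\<Prod>j=0..k - 1. ?P $ (v ! j)) = prod_list (map (($) ?P) v)" if "length v = k" for v
  proof -
    have "{0..k - 1} = {0..<k}" using assms by auto
    then show ?thesis using that by (simp add: prod.list_conv_set_nth)
  qed
  have "(?P ^ k) $ n = (\<Sum>v\<in>natpermute n k. prod_list (map (($) ?P) v))"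
    using assms prod_eq by (simp add: fps_power_nth natpermute_def cong: sum.cong_simp)
  \<comment> \<open>A tuple with an entry above \<open>m\<close> has a vanishing factor.\<close>
  also have "\<dots> = (\<Sum>v\<in>restricted_tuples k n m. prod_list (map (($) ?P) v))"
    by (rule sum.mono_neutral_right[OF natpermute_finite])
       (auto simp: natpermute_def restricted_tuples_def truncated_series_def prod_list_zero_iff
         image_iff not_le)
  also have "\<dots> = (\<Sum>is\<in>restricted_tuples k n m. prod_list (map a is))"
    by (intro sum.cong refl arg_cong[where f = prod_list])
       (auto simp: restricted_tuples_def truncated_series_def)
  finally show ?thesis .
qed

text \<open>Multiplying the expansion of \<open>(1 - P) ^ (n + 1)\<close> by \<open>1 / P\<close> turns its constant term into
  \<open>1 / P\<close> and lowers the exponent of every other term by one. The product itself is divisible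
  by \<open>X ^ (n + 1)\<close>, so the coefficients of \<open>X ^ n\<close> in the expansion add up to zero.\<close>

lemma fps_nth_inverse_eq_sum_powers:
  fixes P :: "'a::field fps"
  assumes "P $ 0 = 1"
  shows "inverse P $ n = (\<Sum>k=0..n. (-1) ^ k * of_nat ((n + 1) choose (k + 1)) * (P ^ k) $ n)"
proof -
  define c :: "nat \<Rightarrow> 'a" where "c k = (-1) ^ k * of_nat ((n + 1) choose (k + 1))" for k
  have inv: "inverse P * P = 1"
    using assms by (simp add: inverse_mult_eq_1)
  have "(1 - P) ^ (n + 1) = (\<Sum>k\<le>n + 1. of_nat ((n + 1) choose k) * (- P) ^ k)"
    using binomial_ring[of "- P" 1 "n + 1"] by simp
  also have "\<dots> = 1 + (\<Sum>k\<le>n. of_nat ((n + 1) choose (k + 1)) * (- P) ^ (k + 1))"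
    by (simp add: sum.atMost_Suc_shift del: sum.atMost_Suc binomial_Suc_Suc power_Suc)
  also have "\<dots> = 1 - (\<Sum>k\<le>n. fps_const (c k) * P ^ k) * P"
  proof -
    have "of_nat ((n + 1) choose (k + 1)) * (- P) ^ (k + 1) = - (fps_const (c k) * P ^ k * P)" for k
    proof -
      have "fps_const (c k) = (-1) ^ k * of_nat ((n + 1) choose (k + 1))"
        unfolding c_def by (simp add: fps_of_nat del: binomial_Suc_Suc
          flip: fps_const_mult fps_const_power fps_const_neg)
      moreover have "(- P) ^ (k + 1) = - ((-1) ^ k * P ^ k * P)"
        by (simp add: power_minus[of P])
      ultimately show ?thesis by (simp only: mult_minus_right mult_ac)
    qed
    then show ?thesis by (simp only: sum_distrib_right sum_negf diff_conv_add_uminus)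
  qed
  finally have "inverse P * (1 - P) ^ (n + 1) =
      inverse P - (\<Sum>k\<le>n. fps_const (c k) * P ^ k) * (inverse P * P)"
    by (simp only: right_diff_distrib mult_1_left mult_1_right mult_ac)
  then have "inverse P * (1 - P) ^ (n + 1) = inverse P - (\<Sum>k\<le>n. fps_const (c k) * P ^ k)"
    by (simp add: inv)
  moreover have "(inverse P * (1 - P) ^ (n + 1)) $ n = 0"
  proof -
    have "((1 - P) ^ (n + 1)) $ i = 0" if "i \<le> n" for i
      using that assms startsby_zero_power_prefix[of "1 - P" "n + 1"] by simp
    then show ?thesis
      unfolding fps_mult_nth by (intro sum.neutral ballI) (simp only: diff_le_self mult_zero_right)
  qed
  ultimately have "(inverse P - (\<Sum>k\<le>n. fps_const (c k) * P ^ k)) $ n = 0"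
    by (rule subst)
  then have "inverse P $ n = (\<Sum>k\<le>n. fps_const (c k) * P ^ k) $ n"
    unfolding fps_sub_nth by (rule eq_iff_diff_eq_0[THEN iffD2])
  then show ?thesis
    by (simp add: fps_sum_nth c_def atMost_atLeast0 del: binomial_Suc_Suc)
qed

text \<open>The sign \<open>(-1) ^ n\<close> is split off so that the remaining sum has the form common to all
  four families.\<close>

lemma fps_nth_inverse_truncated_series:
  assumes "a 0 = 1" and "n \<ge> 1"
  shows "inverse (truncated_series a m) $ n =
    (-1) ^ n * (\<Sum>k=1..n. (-1) ^ (n - k) * of_nat ((n + 1) choose (k + 1)) *
      (\<Sum>is\<in>restricted_tuples k n m. prod_list (map a is)))"
proof -
  let ?P = "truncated_series a m"
  have sign: "(-1) ^ k = (-1) ^ n * (-1 :: 'a) ^ (n - k)" if "k \<le> n" for k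
    using that by (simp add: minus_one_power_iff)
  have "inverse ?P $ n = (\<Sum>k=0..n. (-1) ^ k * of_nat ((n + 1) choose (k + 1)) * (?P ^ k) $ n)"
    using assms by (intro fps_nth_inverse_eq_sum_powers) (simp add: truncated_series_def)
  also have "\<dots> = (\<Sum>k=1..n. (-1) ^ k * of_nat ((n + 1) choose (k + 1)) * (?P ^ k) $ n)"
    using assms(2) by (simp add: sum.atLeast_Suc_atMost del: binomial_Suc_Suc)
  also have "\<dots> = (\<Sum>k=1..n. (-1) ^ n * ((-1) ^ (n - k) * of_nat ((n + 1) choose (k + 1)) *
      (\<Sum>is\<in>restricted_tuples k n m. prod_list (map a is))))"
  proof (rule sum.cong[OF refl])
    fix k assume "k \<in> {1..n}"
    then show "(-1) ^ k * of_nat ((n + 1) choose (k + 1)) * (?P ^ k) $ n =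
        (-1) ^ n * ((-1) ^ (n - k) * of_nat ((n + 1) choose (k + 1)) *
          (\<Sum>is\<in>restricted_tuples k n m. prod_list (map a is)))"
      using sign[of k] by (simp only: fps_nth_power_truncated_series atLeastAtMost_iff mult.assoc)
  qed
  finally show ?thesis by (simp only: sum_distrib_left)
qed

lemma fps_nth_compose_X_square:
  fixes f :: "'a::comm_ring_1 fps"
  shows "(f oo fps_X ^ 2) $ (2 * n) = f $ n"
proof -
  have "(f oo fps_X ^ 2) $ (2 * n) = (\<Sum>i=0..2 * n. if i = n then f $ i else 0)"
    unfolding fps_compose_nth by (intro sum.cong refl) (simp flip: power_mult)
  then show ?thesis by simp
qed

lemma inverse_pochhammer_Suc:
  "1 / pochhammer (of_nat (M + 1)) j = (fact M / fact (M + j) :: 'a::field_char_0)"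
proof -
  have "fact (M + j) = (fact M * pochhammer (of_nat (M + 1)) j :: 'a)"
    using pochhammer_product'[of "1 :: 'a" M j] by (simp add: pochhammer_fact add.commute)
  then show ?thesis by simp
qed

lemma bernoulli_gf_eq: "bernoulli_gf N m = inverse (truncated_series (alpha Bernoulli N) m)"
  unfolding bernoulli_gf_def truncated_series_conv_sum
  by (simp only: inverse_pochhammer_Suc alpha.simps)

lemma cauchy_gf_eq:
  assumes "N \<ge> 1"
  shows "cauchy_gf N m = inverse (truncated_series (alpha Cauchy N) m) oo (- fps_X)"
proof -
  have "cauchy_gf N m = inverse (\<Sum>j=0..m. fps_const (alpha Cauchy N j) * (- fps_X) ^ j)"
    unfolding cauchy_gf_def sum_distrib_left
    by (simp add: mult.assoc[symmetric] fps_const_mult)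
  then show ?thesis
    using assms inverse_sum_eq_compose[of "- fps_X" "alpha Cauchy N" m] by simp
qed

lemma euler_gf_eq:
  "euler_gf N m = inverse (truncated_series (alpha Euler N) m) oo fps_X ^ 2"
proof -
  have "euler_gf N m = inverse (\<Sum>j=0..m. fps_const (alpha Euler N j) * (fps_X ^ 2) ^ j)"
    unfolding euler_gf_def by (simp only: inverse_pochhammer_Suc alpha.simps power_mult)
  then show ?thesis
    using inverse_sum_eq_compose[of "fps_X ^ 2" "alpha Euler N" m] by simp
qed

lemma euler2_gf_eq:
  "euler2_gf N m = inverse (truncated_series (alpha Euler2 N) m) oo fps_X ^ 2"
proof -
  have "1 / pochhammer (of_nat (2 * N + 2)) (2 * j) = alpha Euler2 N j" for j
    using inverse_pochhammer_Suc[of "2 * N + 1" "2 * j", where 'a = rat] by (simp add: add_ac)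
  then have "euler2_gf N m = inverse (\<Sum>j=0..m. fps_const (alpha Euler2 N j) * (fps_X ^ 2) ^ j)"
    unfolding euler2_gf_def by (simp only: power_mult)
  then show ?thesis
    using inverse_sum_eq_compose[of "fps_X ^ 2" "alpha Euler2 N" m] by simp
qed

theorem proposition5:
  fixes F :: family and N n m :: nat
  assumes "N \<ge> 1" and "n \<ge> 1" and "m \<ge> 1"
  shows "A_star F N n m =
    xi F n * (\<Sum>k=1..n. (-1) ^ (n - k) * of_nat ((n + 1) choose (k + 1)) *
      (\<Sum>is\<in>restricted_tuples k n m. prod_list (map (alpha F N) is)))"
proof -
  have "A_star F N n m = xi F n * (-1) ^ n * inverse (truncated_series (alpha F N) m) $ n"
  proof (cases F)
    case Bernoulli
    then show ?thesis
      by (simp add: bernoulli_star_def egf_coeff_def bernoulli_gf_eq)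
  next
    case Cauchy
    \<comment> \<open>Substituting \<open>- X\<close> contributes the factor \<open>(-1) ^ n\<close>, so \<open>xi\<close> itself carries no sign here.\<close>
    then show ?thesis
      using assms by (simp add: cauchy_star_def egf_coeff_def cauchy_gf_eq fps_compose_uminus')
  next
    case Euler
    then show ?thesis
      by (simp add: euler_star_def egf_coeff_def euler_gf_eq fps_nth_compose_X_square)
  next
    case Euler2
    then show ?thesis
      by (simp add: euler2_star_def egf_coeff_def euler2_gf_eq fps_nth_compose_X_square)
  qed
  moreover have "alpha F N 0 = 1"
    using assms(1) by (cases F) simp_all
  ultimately show ?thesis
    using assms(2) by (simp add: fps_nth_inverse_truncated_series del: binomial_Suc_Suc)
qed

end
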